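(* Let $F$ be a field (containing a square root of $-1$ if $\operatorname{char}(F)\neq 2$), let $n\ge 2$, and let $S$ be a finite right-linked set of quadratic $n$-fold Pfister forms over $F$. Then there are a quadratic $(n-1)$-fold Pfister form $\varphi$ and elements $\beta_1,\dots,\beta_s\in F^\times$ such that the elements of the group generated by $S$ in $I_q^nF/I_q^{n+1}F$ are represented by the Pfister forms $\langle\langle\beta_{i_1}\cdots\beta_{i_k}\rangle\rangle\otimes\varphi$ for the subsets $\{i_1,\dots,i_k\}\subseteq\{1,\dots,s\}$.
   Context: $[a,b]$ denotes the quadratic form $ax^2+xy+by^2$. $I_q^1F$ is the group of Witt classes of even-dimensional nonsingular quadratic forms over $F$ under orthogonal sum. Bilinear Pfister forms: $\langle\langle\beta\rangle\rangle=\langle 1,\beta\rangle$ (diagonal symmetric bilinear form) and $\langle\langle\beta_1,\dots,\beta_m\rangle\rangle=\langle\langle\beta_1\rangle\rangle\otimes\cdots\otimes\langle\langle\beta_m\rangle\rangle$, $\beta_i\in F^\times$. Quadratic Pfister forms: the quadratic 1-fold ones are the nonsingular forms $\langle\langle\alpha]]=[1,\alpha]$; the quadratic $n$-fold ones are $\langle\langle\beta_1,\dots,\beta_{n-1},\alpha]]=\langle\langle\beta_1,\dots,\beta_{n-1}\rangle\rangle\otimes\langle\langle\alpha]]$. $I_q^nF$ is the subgroup of $I_q^1F$ generated by scalar multiples of quadratic $n$-fold Pfister forms. A set of quadratic $n$-fold Pfister forms is right-linked if there is a quadratic $(n-1)$-fold Pfister form $\varphi$ such that every form in the set is isometric to $\langle\langle\beta\rangle\rangle\otimes\varphi$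 for some $\beta\in F^\times$. The empty product is $1$. *)

theory Defs
  imports
    "Jordan_Normal_Form.Matrix"
    "HOL-Algebra.Coset"
    "HOL-Algebra.Generated_Groups"
    "HOL-Computational_Algebra.Computational_Algebra"
begin

section \<open>Quadratic forms\<close>

text \<open>A quadratic form $\sum_{i \le j} a_{ij} x_i x_j$ in $m$ variables is represented by the upper
  triangular $m \times m$ matrix of its coefficients. This is meaningful in every characteristic,
  and each form has exactly one such matrix.\<close>

definition quad_form :: "'a::field mat \<Rightarrow> bool" where
  "quad_form q \<longleftrightarrow> square_mat q \<and> upper_triangular q"

definition form_eval :: "'a::field mat \<Rightarrow> 'a vec \<Rightarrow> 'a" where
  "form_eval q v = v \<bullet> (q *\<^sub>v v)"

definition polar :: "'a::field mat \<Rightarrow> 'a vec \<Rightarrow> 'a vec \<Rightarrow> 'a" where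
  "polar q v w = form_eval q (v + w) - form_eval q v - form_eval q w"

text \<open>Nondegeneracy of the polar form is the right notion of nonsingularity for forms of even
  dimension, and it is only used for these.\<close>

definition nonsingular :: "'a::field mat \<Rightarrow> bool" where
  "nonsingular q \<longleftrightarrow> (\<forall>v \<in> carrier_vec (dim_row q).
     (\<forall>w \<in> carrier_vec (dim_row q). polar q v w = 0) \<longrightarrow> v = 0\<^sub>v (dim_row q))"

definition isometric :: "'a::field mat \<Rightarrow> 'a mat \<Rightarrow> bool" where
  "isometric p q \<longleftrightarrow> dim_row p = dim_row q \<and>
     (\<exists>T \<in> carrier_mat (dim_row p) (dim_row p). invertible_mat T \<and>
        (\<forall>v \<in> carrier_vec (dim_row p). form_eval q (T *\<^sub>v v) = form_eval p v))"

definition orth_sum :: "'a::field mat \<Rightarrow> 'a mat \<Rightarrow> 'a mat" where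
  "orth_sum p q = four_block_mat p (0\<^sub>m (dim_row p) (dim_col q)) (0\<^sub>m (dim_row q) (dim_col p)) q"

text \<open>The form $[a,b] = a x^2 + x y + b y^2$.\<close>

definition binary_form :: "'a::field \<Rightarrow> 'a \<Rightarrow> 'a mat" where
  "binary_form a b = mat_of_rows_list 2 [[a, 1], [0, b]]"


section \<open>Pfister forms\<close>

text \<open>The diagonal bilinear form $\langle a_1, \dots, a_k \rangle$ is represented by the list of its
  diagonal entries.\<close>

definition bil_tensor :: "'a::field list \<Rightarrow> 'a list \<Rightarrow> 'a list" where
  "bil_tensor as bs = [a * b. a \<leftarrow> as, b \<leftarrow> bs]"

text \<open>$\langle a_1, \dots, a_k \rangle \otimes q = a_1 q \perp \dots \perp a_k q$.\<close>

definition tensor_form :: "'a::field list \<Rightarrow> 'a mat \<Rightarrow> 'a mat" where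
  "tensor_form as q = diag_block_mat (map (\<lambda>a. a \<cdot>\<^sub>m q) as)"

definition bil_pfister1 :: "'a::field \<Rightarrow> 'a list" where
  "bil_pfister1 \<beta> = [1, \<beta>]"

definition bil_pfister :: "'a::field list \<Rightarrow> 'a list" where
  "bil_pfister \<beta>s = foldr (\<lambda>\<beta>. bil_tensor (bil_pfister1 \<beta>)) \<beta>s [1]"

definition quad_pfister_form :: "'a::field list \<Rightarrow> 'a \<Rightarrow> 'a mat" where
  "quad_pfister_form \<beta>s \<alpha> = tensor_form (bil_pfister \<beta>s) (binary_form 1 \<alpha>)"

text \<open>As usual, being an $n$-fold Pfister form is understood up to isometry. The equation
  for the length forces $n \ge 1$.\<close>

definition quad_pfister :: "nat \<Rightarrow> 'a::field mat \<Rightarrow> bool" where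
  "quad_pfister n q \<longleftrightarrow> quad_form q \<and>
     (\<exists>\<beta>s \<alpha>. Suc (length \<beta>s) = n \<and> (\<forall>\<beta> \<in> set \<beta>s. \<beta> \<noteq> 0) \<and>
        nonsingular (binary_form 1 \<alpha>) \<and> isometric q (quad_pfister_form \<beta>s \<alpha>))"

definition right_linked :: "nat \<Rightarrow> 'a::field mat set \<Rightarrow> bool" where
  "right_linked n S \<longleftrightarrow>
     (\<exists>\<phi>. quad_pfister (n - 1) \<phi> \<and>
        (\<forall>q \<in> S. \<exists>\<beta>. \<beta> \<noteq> 0 \<and> isometric q (tensor_form (bil_pfister1 \<beta>) \<phi>)))"


section \<open>The Witt group and its subgroups\<close>

definition even_nonsingular_forms :: "'a::field mat set" where
  "even_nonsingular_forms = {q. quad_form q \<and> even (dim_row q) \<and> nonsingular q}"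

text \<open>The orthogonal sum of $k$ hyperbolic planes $[0,0]$.\<close>

definition hyperbolic :: "nat \<Rightarrow> 'a::field mat" where
  "hyperbolic k = diag_block_mat (replicate k (binary_form 0 0))"

definition witt_equiv :: "'a::field mat \<Rightarrow> 'a mat \<Rightarrow> bool" where
  "witt_equiv p q \<longleftrightarrow>
     (\<exists>i j. isometric (orth_sum p (hyperbolic i)) (orth_sum q (hyperbolic j)))"

definition witt_class :: "'a::field mat \<Rightarrow> 'a mat set" where
  "witt_class q = {p \<in> even_nonsingular_forms. witt_equiv q p}"

definition witt_group :: "'a::field mat set monoid" where
  "witt_group =
     \<lparr>carrier = witt_class ` even_nonsingular_forms,
      mult = (\<lambda>X Y. \<Union>p\<in>X. \<Union>q\<in>Y. witt_class (orth_sum p q)),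
      one = witt_class (0\<^sub>m 0 0)\<rparr>"

definition Iq :: "nat \<Rightarrow> 'a::field mat set set" where
  "Iq n = generate witt_group {witt_class (c \<cdot>\<^sub>m q) |c q. c \<noteq> 0 \<and> quad_pfister n q}"

definition Iq_quotient :: "nat \<Rightarrow> 'a::field mat set set monoid" where
  "Iq_quotient n = (witt_group\<lparr>carrier := Iq n\<rparr>) Mod (Iq (Suc n))"

text \<open>The class of a form in $I_q^n F / I_q^{n+1} F$.\<close>

definition Iq_class :: "nat \<Rightarrow> 'a::field mat \<Rightarrow> 'a mat set set" where
  "Iq_class n q = Iq (Suc n) #>\<^bsub>witt_group\<^esub> witt_class q"

end

theory Submission
  imports Defs "Jordan_Normal_Form.Determinant"
begin

text \<open>Let \<open>\<phi>\<close> be the common right factor. Since \<open>-1\<close> is a square, \<open>q \<bottom> q\<close> is isometric to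
  \<open>q \<bottom> -q\<close>, hence hyperbolic, so every Witt class has order at most two. In the Witt group,
  \<open>\<langle>\<langle>\<beta>\<rangle>\<rangle> \<otimes> \<phi>\<close>, \<open>\<langle>\<langle>\<gamma>\<rangle>\<rangle> \<otimes> \<phi>\<close> and \<open>\<langle>\<langle>\<beta>\<gamma>\<rangle>\<rangle> \<otimes> \<phi>\<close> then add up to the
  \<open>(n + 1)\<close>-fold Pfister form \<open>\<langle>\<langle>\<beta>, \<gamma>\<rangle>\<rangle> \<otimes> \<phi>\<close>, so \<open>\<beta> \<mapsto> \<langle>\<langle>\<beta>\<rangle>\<rangle> \<otimes> \<phi>\<close> is
  multiplicative modulo \<open>I\<^sub>q\<^sup>n\<^sup>+\<^sup>1F\<close>. The generated group has exponent two, so its elements are the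
  classes of the subset products.\<close>

section \<open>Isometries\<close>

lemma square_mat_carrier: "square_mat q \<Longrightarrow> q \<in> carrier_mat (dim_row q) (dim_row q)"
  by (intro carrier_matI) auto

lemma quad_form_carrier: "quad_form q \<Longrightarrow> q \<in> carrier_mat (dim_row q) (dim_row q)"
  by (simp add: quad_form_def square_mat_carrier)

lemma form_eval_zero:
  assumes "q \<in> carrier_mat n n"
  shows "form_eval q (0\<^sub>v n) = 0"
  using assms by (auto simp: form_eval_def)

lemma polar_zero:
  assumes "q \<in> carrier_mat n n" "w \<in> carrier_vec n"
  shows "polar q (0\<^sub>v n) w = 0"
  using assms by (simp add: polar_def form_eval_zero)

text \<open>A trivial kernel makes \<open>det T\<close> nonzero, and over a field this supplies the
  inverse, so an isometry can be certified by a kernel check alone.\<close>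

lemma isometric_kernelI:
  assumes p: "p \<in> carrier_mat n n" and q: "q \<in> carrier_mat n n" and T: "T \<in> carrier_mat n n"
    and ker: "\<And>v. v \<in> carrier_vec n \<Longrightarrow> T *\<^sub>v v = 0\<^sub>v n \<Longrightarrow> v = 0\<^sub>v n"
    and ev: "\<And>v. v \<in> carrier_vec n \<Longrightarrow> form_eval q (T *\<^sub>v v) = form_eval p v"
  shows "isometric p q"
proof -
  have "det T \<noteq> 0"
    using det_0_iff_vec_prod_zero_field[OF T] ker by blast
  then obtain U where U: "U \<in> carrier_mat n n" "T * U = 1\<^sub>m n"
    using det_non_zero_imp_unit[OF T, where b = "()"] unfolding Units_def ring_mat_def by auto
  have "U * T = 1\<^sub>m n"
    by (rule mat_mult_left_right_inverse[OF T U])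
  then have "invertible_mat T"
    using U T unfolding invertible_mat_def inverts_mat_def by auto
  then show ?thesis
    using assms unfolding isometric_def by auto
qed

text \<open>A value-preserving map also preserves polar forms, so a vector killed by
  \<open>T\<close> is orthogonal to everything under \<open>p\<close>; nonsingularity of
  \<open>p\<close> then forces it to be zero.\<close>

lemma isometricI:
  assumes ns: "nonsingular p"
    and p: "p \<in> carrier_mat n n" and q: "q \<in> carrier_mat n n" and T: "T \<in> carrier_mat n n"
    and ev: "\<And>v. v \<in> carrier_vec n \<Longrightarrow> form_eval q (T *\<^sub>v v) = form_eval p v"
  shows "isometric p q"
proof (rule isometric_kernelI[OF p q T _ ev])
  fix v assume v: "v \<in> carrier_vec n" and Tv: "T *\<^sub>v v = 0\<^sub>v n"
  have "polar p v w = 0" if w: "w \<in> carrier_vec n" for w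
  proof -
    have "polar p v w = polar q (T *\<^sub>v v) (T *\<^sub>v w)"
      using v w ev T by (simp add: polar_def flip: mult_add_distrib_mat_vec)
    then show ?thesis
      using polar_zero[OF q, of "T *\<^sub>v w"] T w by (simp add: Tv)
  qed
  with ns v p show "v = 0\<^sub>v n"
    by (auto simp: nonsingular_def)
qed

lemma isometricE:
  assumes "isometric p q" "p \<in> carrier_mat n n" "q \<in> carrier_mat m m"
  obtains T U where "m = n" "T \<in> carrier_mat n n" "U \<in> carrier_mat n n"
    "T * U = 1\<^sub>m n" "U * T = 1\<^sub>m n"
    "\<And>v. v \<in> carrier_vec n \<Longrightarrow> form_eval q (T *\<^sub>v v) = form_eval p v"
proof -
  have mn: "m = n"
    using assms unfolding isometric_def by auto
  from assms(1,2) obtain T where T: "T \<in> carrier_mat n n" "invertible_mat T"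
    and ev: "\<And>v. v \<in> carrier_vec n \<Longrightarrow> form_eval q (T *\<^sub>v v) = form_eval p v"
    unfolding isometric_def by auto
  from T obtain U where TU: "T * U = 1\<^sub>m n" and UT: "U * T = 1\<^sub>m (dim_row U)"
    unfolding invertible_mat_def inverts_mat_def by auto
  \<comment> \<open>\<open>invertible_mat\<close> leaves the shape of \<open>U\<close> open;
    comparing columns in the two inverse equations fixes both dimensions.\<close>
  have "dim_col U = n"
    using arg_cong[OF TU, of dim_col] by simp
  moreover have "dim_row U = n"
    using arg_cong[OF UT, of dim_col] T by simp
  ultimately have "U \<in> carrier_mat n n"
    by (intro carrier_matI)
  with that mn T TU UT ev show thesis
    by auto
qed

lemma isometric_refl:
  assumes "p \<in> carrier_mat n n"
  shows "isometric p p"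
  by (rule isometric_kernelI[OF assms assms one_carrier_mat]) auto

lemma isometric_sym:
  assumes "isometric p q" and p: "p \<in> carrier_mat n n" and q: "q \<in> carrier_mat m m"
  shows "isometric q p"
proof -
  obtain T U where mn: "m = n" and T: "T \<in> carrier_mat n n" and U: "U \<in> carrier_mat n n"
    and TU: "T * U = 1\<^sub>m n" "U * T = 1\<^sub>m n"
    and ev: "\<And>v. v \<in> carrier_vec n \<Longrightarrow> form_eval q (T *\<^sub>v v) = form_eval p v"
    using isometricE[OF assms] by blast
  have TUv: "T *\<^sub>v (U *\<^sub>v v) = v" if "v \<in> carrier_vec n" for v
    using that TU(1) by (simp flip: assoc_mult_mat_vec[OF T U that])
  show ?thesis
  proof (rule isometric_kernelI[OF q[unfolded mn] p U])
    fix v :: "'a vec" assume v: "v \<in> carrier_vec n"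
    show "form_eval p (U *\<^sub>v v) = form_eval q v"
      using ev[of "U *\<^sub>v v"] TUv[OF v] U v by auto
    show "v = 0\<^sub>v n" if "U *\<^sub>v v = 0\<^sub>v n"
      using TUv[OF v] T that by auto
  qed
qed

lemma isometric_trans:
  assumes pq: "isometric p q" and qr: "isometric q r"
    and p: "p \<in> carrier_mat n n" and q: "q \<in> carrier_mat m m" and r: "r \<in> carrier_mat k k"
  shows "isometric p r"
proof -
  obtain T U where mn: "m = n" and T: "T \<in> carrier_mat n n" and U: "U \<in> carrier_mat n n"
    and TU: "T * U = 1\<^sub>m n" "U * T = 1\<^sub>m n"
    and ev: "\<And>v. v \<in> carrier_vec n \<Longrightarrow> form_eval q (T *\<^sub>v v) = form_eval p v"
    using isometricE[OF pq p q] by blast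
  obtain T' U' where km: "k = m" and T': "T' \<in> carrier_mat m m" and U': "U' \<in> carrier_mat m m"
    and TU': "T' * U' = 1\<^sub>m m" "U' * T' = 1\<^sub>m m"
    and ev': "\<And>v. v \<in> carrier_vec m \<Longrightarrow> form_eval r (T' *\<^sub>v v) = form_eval q v"
    using isometricE[OF qr q r] by blast
  note T' = T'[unfolded mn] and U' = U'[unfolded mn] and TU' = TU'[unfolded mn]
    and ev' = ev'[unfolded mn]
  show ?thesis
  proof (rule isometric_kernelI[OF p r[unfolded km mn] mult_carrier_mat[OF T' T]])
    fix v :: "'a vec" assume v: "v \<in> carrier_vec n"
    have *: "(T' * T) *\<^sub>v v = T' *\<^sub>v (T *\<^sub>v v)"
      by (rule assoc_mult_mat_vec[OF T' T v])
    show "form_eval r ((T' * T) *\<^sub>v v) = form_eval p v"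
      unfolding * using ev ev' T v by auto
    assume "(T' * T) *\<^sub>v v = 0\<^sub>v n"
    then have "U' *\<^sub>v (T' *\<^sub>v (T *\<^sub>v v)) = 0\<^sub>v n"
      using U' unfolding * by auto
    then have "T *\<^sub>v v = 0\<^sub>v n"
      using assoc_mult_mat_vec[OF U' T', of "T *\<^sub>v v"] T v by (simp add: TU')
    then have "U *\<^sub>v (T *\<^sub>v v) = 0\<^sub>v n"
      using U by auto
    then show "v = 0\<^sub>v n"
      using assoc_mult_mat_vec[OF U T v] v by (simp add: TU)
  qed
qed

text \<open>Every \<open>w\<close> is \<open>T\<close> applied to \<open>U w\<close>, so
  \<open>T\<close> carries the radical of the polar form of \<open>p\<close> into that of
  \<open>q\<close>, which is zero.\<close>

lemma nonsingular_isometric: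
  assumes "isometric p q" and p: "p \<in> carrier_mat n n" and q: "q \<in> carrier_mat m m"
    and ns: "nonsingular q"
  shows "nonsingular p"
proof -
  obtain T U where mn: "m = n" and T: "T \<in> carrier_mat n n" and U: "U \<in> carrier_mat n n"
    and TU: "T * U = 1\<^sub>m n" "U * T = 1\<^sub>m n"
    and ev: "\<And>v. v \<in> carrier_vec n \<Longrightarrow> form_eval q (T *\<^sub>v v) = form_eval p v"
    using isometricE[OF assms(1-3)] by blast
  have "v = 0\<^sub>v n" if v: "v \<in> carrier_vec n" and z: "\<And>w. w \<in> carrier_vec n \<Longrightarrow> polar p v w = 0" for v
  proof -
    have "polar q (T *\<^sub>v v) w = 0" if w: "w \<in> carrier_vec n" for w
    proof -
      have w': "U *\<^sub>v w \<in> carrier_vec n"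
        using U w by auto
      have "T *\<^sub>v (U *\<^sub>v w) = w"
        using assoc_mult_mat_vec[OF T U w] TU w by simp
      then have "polar q (T *\<^sub>v v) w = polar p v (U *\<^sub>v w)"
        unfolding polar_def using ev[OF v] ev[OF w'] ev[of "v + U *\<^sub>v w"]
          mult_add_distrib_mat_vec[OF T v w'] v w' by simp
      with z[OF w'] show ?thesis by simp
    qed
    then have "T *\<^sub>v v = 0\<^sub>v n"
      using ns q T v unfolding nonsingular_def mn by auto
    then have "U *\<^sub>v (T *\<^sub>v v) = 0\<^sub>v n"
      using U by auto
    then show ?thesis
      using assoc_mult_mat_vec[OF U T v] v by (simp add: TU)
  qed
  then show ?thesis
    using p by (auto simp: nonsingular_def)
qed


section \<open>Scalar multiples and orthogonal sums\<close>

lemma form_eval_smult: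
  assumes "q \<in> carrier_mat n n" "v \<in> carrier_vec n"
  shows "form_eval (c \<cdot>\<^sub>m q) v = c * form_eval q v"
proof -
  have "(c \<cdot>\<^sub>m q) *\<^sub>v v = c \<cdot>\<^sub>v (q *\<^sub>v v)"
    using assms by (intro eq_vecI) auto
  then show ?thesis
    using assms by (simp add: form_eval_def)
qed

lemma form_eval_smult_vec:
  assumes "q \<in> carrier_mat n n" "v \<in> carrier_vec n"
  shows "form_eval q (c \<cdot>\<^sub>v v) = c\<^sup>2 * form_eval q v"
  using assms by (simp add: form_eval_def mult_mat_vec power2_eq_square)

lemma quad_form_smult: "quad_form q \<Longrightarrow> quad_form (c \<cdot>\<^sub>m q)"
  by (auto simp: quad_form_def upper_triangular_def)

lemma nonsingular_smult:
  assumes "nonsingular q" "c \<noteq> 0" and q: "q \<in> carrier_mat n n"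
  shows "nonsingular (c \<cdot>\<^sub>m q)"
proof -
  have "polar (c \<cdot>\<^sub>m q) v w = c * polar q v w" if "v \<in> carrier_vec n" "w \<in> carrier_vec n" for v w
    using that q by (simp add: polar_def form_eval_smult[OF q] algebra_simps)
  then show ?thesis
    using assms by (auto simp: nonsingular_def)
qed

lemma isometric_smult:
  assumes "isometric p q" and p: "p \<in> carrier_mat n n" and q: "q \<in> carrier_mat m m"
  shows "isometric (c \<cdot>\<^sub>m p) (c \<cdot>\<^sub>m q)"
  using assms unfolding isometric_def by (auto simp: form_eval_smult[OF p] form_eval_smult[OF q])

text \<open>The substitution of \<open>c v\<close> for \<open>v\<close> multiplies the values of a
  quadratic form by the square of \<open>c\<close>. With \<open>c\<close> a square root of
  \<open>-1\<close> this identifies \<open>-p\<close> with \<open>p\<close>.\<close>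

lemma isometric_smult_square:
  assumes p: "p \<in> carrier_mat n n" and c: "c \<noteq> 0"
  shows "isometric (c\<^sup>2 \<cdot>\<^sub>m p) p"
proof (rule isometric_kernelI)
  show "c\<^sup>2 \<cdot>\<^sub>m p \<in> carrier_mat n n" "p \<in> carrier_mat n n" "c \<cdot>\<^sub>m 1\<^sub>m n \<in> carrier_mat n n"
    using p by auto
  fix v :: "'a vec" assume v: "v \<in> carrier_vec n"
  have *: "(c \<cdot>\<^sub>m 1\<^sub>m n) *\<^sub>v v = c \<cdot>\<^sub>v v"
    using v by (intro eq_vecI) auto
  show "form_eval p ((c \<cdot>\<^sub>m 1\<^sub>m n) *\<^sub>v v) = form_eval (c\<^sup>2 \<cdot>\<^sub>m p) v"
    unfolding * by (simp add: form_eval_smult[OF p v] form_eval_smult_vec[OF p v])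
  show "v = 0\<^sub>v n" if "(c \<cdot>\<^sub>m 1\<^sub>m n) *\<^sub>v v = 0\<^sub>v n"
    using that c v unfolding * by (auto simp: vec_eq_iff)
qed

section \<open>Orthogonal sums\<close>

lemma orth_sum_carrier:
  assumes "p \<in> carrier_mat m m" "q \<in> carrier_mat k k"
  shows "orth_sum p q \<in> carrier_mat (m + k) (m + k)"
  using assms by (auto simp: orth_sum_def)

text \<open>Both sides are the same block matrix, so sums can be regrouped by rewriting, without
  passing to an isometry.\<close>

lemma orth_sum_assoc: "orth_sum (orth_sum p q) r = orth_sum p (orth_sum q r)"
  unfolding orth_sum_def by (rule assoc_four_block_mat[symmetric])

lemma orth_sum_empty_left: "orth_sum (0\<^sub>m 0 0) q = q"
  by (rule eq_matI) (auto simp: orth_sum_def)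

lemma orth_sum_empty_right: "orth_sum q (0\<^sub>m 0 0) = q"
  by (rule eq_matI) (auto simp: orth_sum_def)

lemma diag_block_mat_Cons: "diag_block_mat (A # As) = orth_sum A (diag_block_mat As)"
  by (simp add: orth_sum_def Let_def)

lemma diag_block_mat_append_orth_sum:
  "diag_block_mat (As @ Bs) = orth_sum (diag_block_mat As) (diag_block_mat Bs)"
  by (simp add: diag_block_mat_append orth_sum_def Let_def)

lemma orth_sum_smult: "c \<cdot>\<^sub>m orth_sum p q = orth_sum (c \<cdot>\<^sub>m p) (c \<cdot>\<^sub>m q)"
  by (rule eq_matI) (auto simp: orth_sum_def)

lemma carrier_vec_appendE:
  assumes "v \<in> carrier_vec (m + k)"
  obtains a b where "a \<in> carrier_vec m" "b \<in> carrier_vec k" "v = a @\<^sub>v b"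
  using assms vec_first_last_append[OF assms] that[of "vec_first v m" "vec_last v k"] by simp

lemma form_eval_orth_sum:
  assumes p: "p \<in> carrier_mat m m" and q: "q \<in> carrier_mat k k"
    and a: "a \<in> carrier_vec m" and b: "b \<in> carrier_vec k"
  shows "form_eval (orth_sum p q) (a @\<^sub>v b) = form_eval p a + form_eval q b"
proof -
  have "orth_sum p q *\<^sub>v (a @\<^sub>v b) = p *\<^sub>v a @\<^sub>v q *\<^sub>v b"
    using mult_mat_vec_split[OF p q a b] p q by (simp add: orth_sum_def)
  then show ?thesis
    using scalar_prod_append[OF a b, of "p *\<^sub>v a" "q *\<^sub>v b"] p q a b
    by (simp add: form_eval_def)
qed

lemma append_add_vec:
  assumes "a \<in> carrier_vec m" "c \<in> carrier_vec m" "b \<in> carrier_vec k" "d \<in> carrier_vec k"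
  shows "(a @\<^sub>v b) + (c @\<^sub>v d) = (a + c) @\<^sub>v (b + d)"
  using assms by (intro eq_vecI) auto

lemma polar_orth_sum:
  assumes p: "p \<in> carrier_mat m m" and q: "q \<in> carrier_mat k k"
    and a: "a \<in> carrier_vec m" "c \<in> carrier_vec m" and b: "b \<in> carrier_vec k" "d \<in> carrier_vec k"
  shows "polar (orth_sum p q) (a @\<^sub>v b) (c @\<^sub>v d) = polar p a c + polar q b d"
  using a b by (simp add: polar_def append_add_vec[OF a b] form_eval_orth_sum[OF p q])

lemma append_zero_vec: "0\<^sub>v m @\<^sub>v 0\<^sub>v k = 0\<^sub>v (m + k)"
  by (intro eq_vecI) auto

lemma polar_zero_right:
  assumes "q \<in> carrier_mat n n" "w \<in> carrier_vec n"
  shows "polar q w (0\<^sub>v n) = 0"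
  using assms by (simp add: polar_def form_eval_zero)

text \<open>Testing a radical vector against vectors supported in a single summand separates the two
  polar forms.\<close>

lemma nonsingular_orth_sum:
  assumes p: "p \<in> carrier_mat m m" and q: "q \<in> carrier_mat k k"
    and ns: "nonsingular p" "nonsingular q"
  shows "nonsingular (orth_sum p q)"
proof -
  have "v = 0\<^sub>v (m + k)" if v: "v \<in> carrier_vec (m + k)"
    and z: "\<And>w. w \<in> carrier_vec (m + k) \<Longrightarrow> polar (orth_sum p q) v w = 0" for v
  proof -
    from v obtain a b where a: "a \<in> carrier_vec m" and b: "b \<in> carrier_vec k" and ab: "v = a @\<^sub>v b"
      by (rule carrier_vec_appendE)
    have "polar p a c = 0" if c: "c \<in> carrier_vec m" for c
      using z[of "c @\<^sub>v 0\<^sub>v k"] polar_orth_sum[OF p q a c b, of "0\<^sub>v k"] polar_zero_right[OF q b] c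
      by (simp add: ab)
    moreover have "polar q b d = 0" if d: "d \<in> carrier_vec k" for d
      using z[of "0\<^sub>v m @\<^sub>v d"] polar_orth_sum[OF p q a _ b d, of "0\<^sub>v m"] polar_zero_right[OF p a] d
      by (simp add: ab)
    ultimately have "a = 0\<^sub>v m" "b = 0\<^sub>v k"
      using ns a b p q unfolding nonsingular_def by auto
    then show ?thesis
      by (simp add: ab append_zero_vec)
  qed
  then show ?thesis
    using orth_sum_carrier[OF p q] by (auto simp: nonsingular_def)
qed

lemma quad_form_orth_sum:
  assumes "quad_form p" "quad_form q"
  shows "quad_form (orth_sum p q)"
  using assms by (auto simp: quad_form_def upper_triangular_def orth_sum_def)

text \<open>The block diagonal matrix \<open>orth_sum T T'\<close> is the isometry; its kernel is
  trivial because \<open>U\<close> and \<open>U'\<close> undo the two blocks.\<close>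

lemma isometric_orth_sum:
  assumes pp: "isometric p p'" and qq: "isometric q q'"
    and p: "p \<in> carrier_mat m m" and p': "p' \<in> carrier_mat m' m'"
    and q: "q \<in> carrier_mat k k" and q': "q' \<in> carrier_mat k' k'"
  shows "isometric (orth_sum p q) (orth_sum p' q')"
proof -
  obtain T U where m: "m' = m" and T: "T \<in> carrier_mat m m" and U: "U \<in> carrier_mat m m"
    and UT: "T * U = 1\<^sub>m m" "U * T = 1\<^sub>m m"
    and ev: "\<And>v. v \<in> carrier_vec m \<Longrightarrow> form_eval p' (T *\<^sub>v v) = form_eval p v"
    using isometricE[OF pp p p'] by blast
  obtain T' U' where k: "k' = k" and T': "T' \<in> carrier_mat k k" and U': "U' \<in> carrier_mat k k"
    and UT': "T' * U' = 1\<^sub>m k" "U' * T' = 1\<^sub>m k"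
    and ev': "\<And>v. v \<in> carrier_vec k \<Longrightarrow> form_eval q' (T' *\<^sub>v v) = form_eval q v"
    using isometricE[OF qq q q'] by blast
  note p' = p'[unfolded m] and q' = q'[unfolded k]
  have OT: "orth_sum T T' *\<^sub>v (a @\<^sub>v b) = T *\<^sub>v a @\<^sub>v T' *\<^sub>v b"
    if "a \<in> carrier_vec m" "b \<in> carrier_vec k" for a b
    using mult_mat_vec_split[OF T T' that] T T' by (simp add: orth_sum_def)
  show ?thesis
  proof (rule isometric_kernelI[OF orth_sum_carrier[OF p q] orth_sum_carrier[OF p' q']
        orth_sum_carrier[OF T T']])
    fix v :: "'a vec" assume "v \<in> carrier_vec (m + k)"
    then obtain a b where a: "a \<in> carrier_vec m" and b: "b \<in> carrier_vec k" and ab: "v = a @\<^sub>v b"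
      by (rule carrier_vec_appendE)
    have Ta: "T *\<^sub>v a \<in> carrier_vec m" and Tb: "T' *\<^sub>v b \<in> carrier_vec k"
      using T T' a b by auto
    show "form_eval (orth_sum p' q') (orth_sum T T' *\<^sub>v v) = form_eval (orth_sum p q) v"
      unfolding ab OT[OF a b] form_eval_orth_sum[OF p q a b] form_eval_orth_sum[OF p' q' Ta Tb]
      by (simp add: ev[OF a] ev'[OF b])
    assume "orth_sum T T' *\<^sub>v v = 0\<^sub>v (m + k)"
    then have "T *\<^sub>v a = 0\<^sub>v m \<and> T' *\<^sub>v b = 0\<^sub>v k"
      unfolding ab OT[OF a b] append_zero_vec[symmetric] using append_vec_eq[OF Ta] by auto
    then have "U *\<^sub>v (T *\<^sub>v a) = 0\<^sub>v m" "U' *\<^sub>v (T' *\<^sub>v b) = 0\<^sub>v k"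
      using U U' by auto
    then show "v = 0\<^sub>v (m + k)"
      using assoc_mult_mat_vec[OF U T a] assoc_mult_mat_vec[OF U' T' b] a b
      by (simp add: UT UT' ab append_zero_vec)
  qed
qed

lemma isometric_orth_sum_comm:
  assumes p: "p \<in> carrier_mat m m" and q: "q \<in> carrier_mat k k"
  shows "isometric (orth_sum p q) (orth_sum q p)"
proof -
  \<comment> \<open>This matrix exchanges the two coordinate blocks, sending (a, b) to (b,
    a).\<close>
  let ?T = "four_block_mat (0\<^sub>m k m) (1\<^sub>m k) (1\<^sub>m m) (0\<^sub>m m k) :: 'a mat"
  have T: "?T \<in> carrier_mat (m + k) (m + k)"
    by (intro carrier_matI) auto
  have Tab: "?T *\<^sub>v (a @\<^sub>v b) = b @\<^sub>v a" if "a \<in> carrier_vec m" "b \<in> carrier_vec k" for a b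
    by (subst four_block_mat_mult_vec[of _ k m _ k _ m]) (use that in auto)
  show ?thesis
  proof (rule isometric_kernelI[OF orth_sum_carrier[OF p q] _ T])
    show "orth_sum q p \<in> carrier_mat (m + k) (m + k)"
      using orth_sum_carrier[OF q p] by (simp add: add.commute)
    fix v :: "'a vec" assume "v \<in> carrier_vec (m + k)"
    then obtain a b where a: "a \<in> carrier_vec m" and b: "b \<in> carrier_vec k" and ab: "v = a @\<^sub>v b"
      by (rule carrier_vec_appendE)
    show "form_eval (orth_sum q p) (?T *\<^sub>v v) = form_eval (orth_sum p q) v"
      unfolding ab Tab[OF a b] form_eval_orth_sum[OF p q a b] form_eval_orth_sum[OF q p b a]
      by simp
    assume "?T *\<^sub>v v = 0\<^sub>v (m + k)"
    then have "b @\<^sub>v a = 0\<^sub>v k @\<^sub>v 0\<^sub>v m"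
      unfolding ab Tab[OF a b] append_zero_vec by (simp add: add.commute)
    then have "b = 0\<^sub>v k \<and> a = 0\<^sub>v m"
      using append_vec_eq[OF b zero_carrier_vec] by blast
    then show "v = 0\<^sub>v (m + k)"
      by (simp add: ab append_zero_vec)
  qed
qed


section \<open>Hyperbolic forms\<close>

lemma hyperbolic_0: "hyperbolic 0 = 0\<^sub>m 0 0"
  by (simp add: hyperbolic_def)

lemma hyperbolic_Suc: "hyperbolic (Suc k) = orth_sum (binary_form 0 0) (hyperbolic k)"
  unfolding hyperbolic_def replicate_Suc by (rule diag_block_mat_Cons)

lemma hyperbolic_add: "orth_sum (hyperbolic i) (hyperbolic j) = hyperbolic (i + j)"
  by (simp add: hyperbolic_def replicate_add diag_block_mat_append_orth_sum)

lemma binary_form_carrier: "binary_form a b \<in> carrier_mat 2 2"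
  by (auto simp: binary_form_def mat_of_rows_list_def)

lemma form_eval_binary_form:
  assumes "v \<in> carrier_vec 2"
  shows "form_eval (binary_form a b) v = a * (v $ 0)\<^sup>2 + v $ 0 * v $ 1 + b * (v $ 1)\<^sup>2"
  using assms
  by (auto simp: form_eval_def binary_form_def mat_of_rows_list_def scalar_prod_def
      mult_mat_vec_def numeral_2_eq_2 algebra_simps)

lemma quad_form_binary_form: "quad_form (binary_form a b)"
  by (auto simp: quad_form_def binary_form_def mat_of_rows_list_def upper_triangular_def
      less_Suc_eq numeral_2_eq_2)

lemma hyperbolic_carrier: "hyperbolic k \<in> carrier_mat (2 * k) (2 * k)"
proof (induction k)
  case (Suc k)
  show ?case
    using orth_sum_carrier[OF binary_form_carrier Suc, of 0 0] by (simp add: hyperbolic_Suc)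
qed (simp add: hyperbolic_0)

lemma form_eval_hyperbolic:
  assumes "v \<in> carrier_vec (2 * k)"
  shows "form_eval (hyperbolic k) v = (\<Sum>i<k. v $ (2 * i) * v $ (2 * i + 1))"
  using assms
proof (induction k arbitrary: v)
  case (Suc k)
  have "v \<in> carrier_vec (2 + 2 * k)"
    using Suc.prems by simp
  then obtain a b where a: "a \<in> carrier_vec 2" and b: "b \<in> carrier_vec (2 * k)" and ab: "v = a @\<^sub>v b"
    by (rule carrier_vec_appendE)
  have "form_eval (hyperbolic (Suc k)) v = a $ 0 * a $ 1 + (\<Sum>i<k. b $ (2 * i) * b $ (2 * i + 1))"
    unfolding ab hyperbolic_Suc form_eval_orth_sum[OF binary_form_carrier hyperbolic_carrier a b]
    by (simp add: form_eval_binary_form[OF a] Suc.IH[OF b])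
  also have "\<dots> = (\<Sum>i<Suc k. v $ (2 * i) * v $ (2 * i + 1))"
    unfolding sum.lessThan_Suc_shift using a b by (simp add: ab)
  finally show ?case .
qed (auto simp: hyperbolic_0 form_eval_def scalar_prod_def)

text \<open>If \<open>q\<close> has matrix \<open>Q\<close>, then \<open>q(x) - q(y) = u \<bullet> d\<close> with \<open>u = Q x + Q\<^sup>T y\<close> and
  \<open>d = x - y\<close>; this holds in every characteristic. The substitution below also interleaves the
  coordinates of \<open>u\<close> and \<open>d\<close>.\<close>

lemma isometric_orth_sum_uminus_hyperbolic:
  fixes q :: "'a::field mat"
  assumes q: "q \<in> carrier_mat n n" and ns: "nonsingular q"
  shows "isometric (orth_sum q (-1 \<cdot>\<^sub>m q)) (hyperbolic n)"
proof -
  \<comment> \<open>\<open>hyperbolic n\<close> multiplies the coordinates \<open>2 * i\<close> and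
    \<open>2 * i + 1\<close>. Hence \<open>P\<close> must read entry \<open>i\<close> of
    \<open>u\<close> into the even position and entry \<open>i\<close> of \<open>d\<close>, stored
    at \<open>n + i\<close>, into the odd one.\<close>
  define \<sigma> where "\<sigma> i = (if even i then i div 2 else n + i div 2)" for i
  define P :: "'a mat" where "P = mat (2 * n) (2 * n) (\<lambda>(i, j). if j = \<sigma> i then 1 else 0)"
  let ?T = "four_block_mat q (transpose_mat q) (1\<^sub>m n) (-1 \<cdot>\<^sub>m 1\<^sub>m n)"
  have q': "-1 \<cdot>\<^sub>m q \<in> carrier_mat n n"
    using q by simp
  have nn: "n + n = 2 * n"
    by simp
  have P: "P \<in> carrier_mat (n + n) (n + n)"
    unfolding nn by (simp add: P_def)
  have T: "?T \<in> carrier_mat (n + n) (n + n)"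
    by (rule four_block_carrier_mat) (use q in auto)
  show ?thesis
  \<comment> \<open>Through \<open>isometricI\<close>, injectivity of \<open>P * ?T\<close> comes
    from the nonsingularity of the source form rather than from a computation of the kernel.\<close>
  proof (rule isometricI[OF _ orth_sum_carrier[OF q q'] _ mult_carrier_mat[OF P T]])
    show "nonsingular (orth_sum q (-1 \<cdot>\<^sub>m q))"
      using q ns by (intro nonsingular_orth_sum nonsingular_smult) auto
    show "hyperbolic n \<in> carrier_mat (n + n) (n + n)"
      using hyperbolic_carrier[of n] by (simp add: nn)
    fix v :: "'a vec" assume v: "v \<in> carrier_vec (n + n)"
    then obtain x y where x: "x \<in> carrier_vec n" and y: "y \<in> carrier_vec n" and xy: "v = x @\<^sub>v y"
      by (rule carrier_vec_appendE)
    define u where "u = q *\<^sub>v x + transpose_mat q *\<^sub>v y"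
    define d where "d = x - y"
    have u: "u \<in> carrier_vec n" and d: "d \<in> carrier_vec n"
      using q x y by (auto simp: u_def d_def)
    have y1: "(-1 \<cdot>\<^sub>m 1\<^sub>m n) *\<^sub>v y = - y"
      using y by (intro eq_vecI) auto
    have "?T *\<^sub>v v = u @\<^sub>v (x + - y)"
      unfolding xy u_def by (subst four_block_mat_mult_vec[of _ n n _ n _ n]) (use q x y y1 in auto)
    also have "x + - y = d"
      using x y by (auto simp: d_def)
    finally have Tv: "?T *\<^sub>v v = u @\<^sub>v d" .
    have Pw: "(P *\<^sub>v w) $ i = w $ \<sigma> i" if "w \<in> carrier_vec (2 * n)" "i < 2 * n" for w i
    proof -
      have "\<sigma> i < 2 * n"
        using that by (auto simp: \<sigma>_def)
      then show ?thesis
        using that by (simp add: P_def mult_mat_vec_def scalar_prod_def if_distrib[of "\<lambda>x. x * _"] sum.delta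
            cong: if_cong)
    qed
    have ud: "u @\<^sub>v d \<in> carrier_vec (2 * n)"
      using u d by (simp add: nn[symmetric])
    have "form_eval (hyperbolic n) ((P * ?T) *\<^sub>v v)
        = (\<Sum>i<n. (P *\<^sub>v (u @\<^sub>v d)) $ (2 * i) * (P *\<^sub>v (u @\<^sub>v d)) $ (2 * i + 1))"
      unfolding assoc_mult_mat_vec[OF P T v] Tv
      by (rule form_eval_hyperbolic) (use mult_mat_vec_carrier[OF P[unfolded nn] ud] in simp)
    also have "\<dots> = (\<Sum>i<n. u $ i * d $ i)"
      by (rule sum.cong) (use u d ud in \<open>auto simp: Pw \<sigma>_def\<close>)
    also have "\<dots> = u \<bullet> d"
      using d by (simp add: scalar_prod_def atLeast0LessThan)
    also have "\<dots> = (q *\<^sub>v x) \<bullet> x + (transpose_mat q *\<^sub>v y) \<bullet> x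
        - ((q *\<^sub>v x) \<bullet> y + (transpose_mat q *\<^sub>v y) \<bullet> y)"
      using q x y unfolding u_def d_def
      by (simp add: scalar_prod_minus_distrib[of _ n] add_scalar_prod_distrib[of _ n])
    \<comment> \<open>The two mixed terms agree and cancel, which leaves q(x) - q(y).\<close>
    also have "(q *\<^sub>v x) \<bullet> y = (transpose_mat q *\<^sub>v y) \<bullet> x"
      using transpose_vec_mult_scalar[OF q x y] comm_scalar_prod[of "q *\<^sub>v x" n y] q x y by simp
    also have "(transpose_mat q *\<^sub>v y) \<bullet> y = form_eval q y"
      using transpose_vec_mult_scalar[OF q y y] by (simp add: form_eval_def)
    also have "(q *\<^sub>v x) \<bullet> x = form_eval q x"
      using comm_scalar_prod[of "q *\<^sub>v x" n x] q x by (simp add: form_eval_def)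
    finally show "form_eval (hyperbolic n) ((P * ?T) *\<^sub>v v) = form_eval (orth_sum q (-1 \<cdot>\<^sub>m q)) v"
      unfolding xy form_eval_orth_sum[OF q q' x y] form_eval_smult[OF q y] by simp
  qed
qed


section \<open>The Witt group\<close>

lemma even_nonsingular_forms_carrier:
  "q \<in> even_nonsingular_forms \<Longrightarrow> q \<in> carrier_mat (dim_row q) (dim_row q)"
  by (simp add: even_nonsingular_forms_def quad_form_carrier)

lemma dim_row_orth_sum: "dim_row (orth_sum p q) = dim_row p + dim_row q"
  by (simp add: orth_sum_def)

lemma orth_sum_even_nonsingular:
  assumes p: "p \<in> even_nonsingular_forms" and q: "q \<in> even_nonsingular_forms"
  shows "orth_sum p q \<in> even_nonsingular_forms"
proof -
  have "nonsingular (orth_sum p q)"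
    by (rule nonsingular_orth_sum[OF even_nonsingular_forms_carrier[OF p]
          even_nonsingular_forms_carrier[OF q]])
      (use p q in \<open>simp_all add: even_nonsingular_forms_def\<close>)
  with p q show ?thesis
    by (simp add: even_nonsingular_forms_def quad_form_orth_sum dim_row_orth_sum)
qed

lemma smult_even_nonsingular:
  assumes q: "q \<in> even_nonsingular_forms" and c: "c \<noteq> 0"
  shows "c \<cdot>\<^sub>m q \<in> even_nonsingular_forms"
proof -
  have "nonsingular (c \<cdot>\<^sub>m q)"
    by (rule nonsingular_smult[OF _ c even_nonsingular_forms_carrier[OF q]])
      (use q in \<open>simp add: even_nonsingular_forms_def\<close>)
  with q show ?thesis
    by (simp add: even_nonsingular_forms_def quad_form_smult)
qed

lemma empty_even_nonsingular: "0\<^sub>m 0 0 \<in> even_nonsingular_forms"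
  by (auto simp: even_nonsingular_forms_def quad_form_def upper_triangular_def nonsingular_def)

section \<open>Witt equivalence and its compatibility with orthogonal sums\<close>

lemma isometric_imp_witt_equiv:
  assumes "isometric p q"
  shows "witt_equiv p q"
  unfolding witt_equiv_def
  by (intro exI[of _ 0]) (use assms in \<open>simp add: hyperbolic_0 orth_sum_empty_right\<close>)

lemma witt_equiv_sym:
  assumes "witt_equiv p q" and p: "p \<in> carrier_mat m m" and q: "q \<in> carrier_mat k k"
  shows "witt_equiv q p"
proof -
  from assms(1) obtain i j where
    "isometric (orth_sum p (hyperbolic i)) (orth_sum q (hyperbolic j))"
    unfolding witt_equiv_def by blast
  from isometric_sym[OF this orth_sum_carrier[OF p hyperbolic_carrier]
      orth_sum_carrier[OF q hyperbolic_carrier]]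
  show ?thesis
    unfolding witt_equiv_def by blast
qed

text \<open>Adding \<open>i'\<close> planes to the first isometry and \<open>j\<close> planes to the
  second turns both middle forms into \<open>q\<close> plus \<open>i' + j\<close> planes, so the two
  isometries can be composed.\<close>

lemma witt_equiv_trans:
  assumes pq: "witt_equiv p q" and qr: "witt_equiv q r"
    and p: "p \<in> carrier_mat m m" and q: "q \<in> carrier_mat k k" and r: "r \<in> carrier_mat l l"
  shows "witt_equiv p r"
proof -
  from pq obtain i j where
    1: "isometric (orth_sum p (hyperbolic i)) (orth_sum q (hyperbolic j))"
    unfolding witt_equiv_def by blast
  from qr obtain i' j' where
    2: "isometric (orth_sum q (hyperbolic i')) (orth_sum r (hyperbolic j'))"
    unfolding witt_equiv_def by blast
  have "isometric (orth_sum (orth_sum p (hyperbolic i)) (hyperbolic i'))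
      (orth_sum (orth_sum q (hyperbolic j)) (hyperbolic i'))"
    by (rule isometric_orth_sum[OF 1 isometric_refl]) (rule orth_sum_carrier hyperbolic_carrier p q r)+
  then have 3: "isometric (orth_sum p (hyperbolic (i + i'))) (orth_sum q (hyperbolic (i' + j)))"
    by (simp add: orth_sum_assoc hyperbolic_add add.commute)
  have "isometric (orth_sum (orth_sum q (hyperbolic i')) (hyperbolic j))
      (orth_sum (orth_sum r (hyperbolic j')) (hyperbolic j))"
    by (rule isometric_orth_sum[OF 2 isometric_refl]) (rule orth_sum_carrier hyperbolic_carrier p q r)+
  then have 4: "isometric (orth_sum q (hyperbolic (i' + j))) (orth_sum r (hyperbolic (j' + j)))"
    by (simp add: orth_sum_assoc hyperbolic_add)
  have "isometric (orth_sum p (hyperbolic (i + i'))) (orth_sum r (hyperbolic (j' + j)))"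
    by (rule isometric_trans[OF 3 4]) (rule orth_sum_carrier hyperbolic_carrier p q r)+
  then show ?thesis
    unfolding witt_equiv_def by blast
qed

lemma witt_equiv_orth_sum_left:
  assumes "witt_equiv p p'"
    and p: "p \<in> carrier_mat m m" and p': "p' \<in> carrier_mat m' m'" and q: "q \<in> carrier_mat k k"
  shows "witt_equiv (orth_sum q p) (orth_sum q p')"
proof -
  from assms(1) obtain i j where
    1: "isometric (orth_sum p (hyperbolic i)) (orth_sum p' (hyperbolic j))"
    unfolding witt_equiv_def by blast
  have "isometric (orth_sum q (orth_sum p (hyperbolic i))) (orth_sum q (orth_sum p' (hyperbolic j)))"
    by (rule isometric_orth_sum[OF isometric_refl 1]) (rule orth_sum_carrier hyperbolic_carrier p p' q)+
  then show ?thesis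
    unfolding witt_equiv_def orth_sum_assoc by blast
qed

text \<open>The summands are changed one at a time; the swap isometry brings each into the
  right-hand position, where \<open>witt_equiv_orth_sum_left\<close> applies.\<close>

lemma witt_equiv_orth_sum:
  assumes pp: "witt_equiv p p'" and qq: "witt_equiv q q'"
    and p: "p \<in> carrier_mat m m" and p': "p' \<in> carrier_mat m' m'"
    and q: "q \<in> carrier_mat k k" and q': "q' \<in> carrier_mat k' k'"
  shows "witt_equiv (orth_sum p q) (orth_sum p' q')"
proof -
  have 1: "witt_equiv (orth_sum p q) (orth_sum p q')"
    by (rule witt_equiv_orth_sum_left[OF qq q q' p])
  have 2: "witt_equiv (orth_sum p q') (orth_sum q' p)"
    by (rule isometric_imp_witt_equiv[OF isometric_orth_sum_comm[OF p q']])
  have 3: "witt_equiv (orth_sum q' p) (orth_sum q' p')"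
    by (rule witt_equiv_orth_sum_left[OF pp p p' q'])
  have 4: "witt_equiv (orth_sum q' p') (orth_sum p' q')"
    by (rule isometric_imp_witt_equiv[OF isometric_orth_sum_comm[OF q' p']])
  note c = orth_sum_carrier[OF p q] orth_sum_carrier[OF p q'] orth_sum_carrier[OF q' p]
    orth_sum_carrier[OF q' p'] orth_sum_carrier[OF p' q']
  show ?thesis
    by (rule witt_equiv_trans[OF 1 witt_equiv_trans[OF 2 witt_equiv_trans[OF 3 4 c(3,4,5)] c(2,3,5)]
          c(1,2,5)])
qed

section \<open>Witt classes and their group structure\<close>

lemma witt_class_eqI:
  assumes "witt_equiv p q" "p \<in> even_nonsingular_forms" "q \<in> even_nonsingular_forms"
  shows "witt_class p = witt_class q"
proof -
  note c = even_nonsingular_forms_carrier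
  have qp: "witt_equiv q p"
    by (rule witt_equiv_sym[OF assms(1) c[OF assms(2)] c[OF assms(3)]])
  have "witt_equiv p r \<longleftrightarrow> witt_equiv q r" if "r \<in> even_nonsingular_forms" for r
    using witt_equiv_trans[OF assms(1) _ c[OF assms(2)] c[OF assms(3)] c[OF that]]
      witt_equiv_trans[OF qp _ c[OF assms(3)] c[OF assms(2)] c[OF that]] by blast
  then show ?thesis
    by (auto simp: witt_class_def)
qed

lemma witt_class_isometric:
  "isometric p q \<Longrightarrow> p \<in> even_nonsingular_forms \<Longrightarrow> q \<in> even_nonsingular_forms \<Longrightarrow>
    witt_class p = witt_class q"
  by (rule witt_class_eqI[OF isometric_imp_witt_equiv])

lemma witt_class_self:
  "q \<in> even_nonsingular_forms \<Longrightarrow> q \<in> witt_class q"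
  by (simp add: witt_class_def isometric_imp_witt_equiv
      isometric_refl[OF even_nonsingular_forms_carrier])

lemma carrier_witt_group: "carrier witt_group = witt_class ` even_nonsingular_forms"
  by (simp add: witt_group_def)

lemma one_witt_group: "\<one>\<^bsub>witt_group\<^esub> = witt_class (0\<^sub>m 0 0)"
  by (simp add: witt_group_def)

lemma witt_class_in_carrier:
  "q \<in> even_nonsingular_forms \<Longrightarrow> witt_class q \<in> carrier witt_group"
  by (simp add: carrier_witt_group)

text \<open>The group product is a union over all pairs of representatives. All these sums are Witt
  equivalent, so the union collapses to one class; its index sets are nonempty because each form
  lies in its own class.\<close>

lemma witt_class_orth_sum:
  assumes p: "p \<in> even_nonsingular_forms" and q: "q \<in> even_nonsingular_forms"
  shows "witt_class (orth_sum p q) = witt_class p \<otimes>\<^bsub>witt_group\<^esub> witt_class q"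
proof -
  have "witt_class (orth_sum p' q') = witt_class (orth_sum p q)"
    if "p' \<in> witt_class p" "q' \<in> witt_class q" for p' q'
  proof -
    have p': "p' \<in> even_nonsingular_forms" "witt_equiv p p'"
      and q': "q' \<in> even_nonsingular_forms" "witt_equiv q q'"
      using that by (auto simp: witt_class_def)
    have "witt_equiv (orth_sum p q) (orth_sum p' q')"
      by (rule witt_equiv_orth_sum[OF p'(2) q'(2)])
        (use p q p' q' in \<open>blast intro: even_nonsingular_forms_carrier\<close>)+
    from witt_class_eqI[OF this] show ?thesis
      using p q p' q' orth_sum_even_nonsingular by auto
  qed
  then have "(\<Union>p'\<in>witt_class p. \<Union>q'\<in>witt_class q. witt_class (orth_sum p' q'))
      = (\<Union>p'\<in>witt_class p. \<Union>q'\<in>witt_class q. witt_class (orth_sum p q))"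
    by (intro SUP_cong refl)
  also have "\<dots> = witt_class (orth_sum p q)"
    using witt_class_self[OF p] witt_class_self[OF q] by blast
  finally show ?thesis
    by (simp add: witt_group_def)
qed

text \<open>Zero planes on one side and \<open>k\<close> on the other witness equivalence with the
  empty form. The membership hypothesis is discharged in \<open>witt_class_uminus\<close>.\<close>

lemma witt_class_hyperbolic:
  assumes "(hyperbolic k :: 'a::field mat) \<in> even_nonsingular_forms"
  shows "witt_class (hyperbolic k :: 'a mat) = \<one>\<^bsub>witt_group\<^esub>"
proof -
  have "isometric (orth_sum (hyperbolic k :: 'a mat) (hyperbolic 0)) (orth_sum (0\<^sub>m 0 0) (hyperbolic k))"
    using isometric_refl[OF hyperbolic_carrier, of k]
    by (simp add: hyperbolic_0 orth_sum_empty_left orth_sum_empty_right)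
  then have "witt_equiv (hyperbolic k :: 'a mat) (0\<^sub>m 0 0)"
    unfolding witt_equiv_def by blast
  from witt_class_eqI[OF this assms empty_even_nonsingular] show ?thesis
    by (simp add: one_witt_group)
qed

lemma witt_class_uminus:
  fixes q :: "'a::field mat"
  assumes q: "q \<in> even_nonsingular_forms"
  shows "witt_class q \<otimes>\<^bsub>witt_group\<^esub> witt_class (-1 \<cdot>\<^sub>m q) = \<one>\<^bsub>witt_group\<^esub>"
proof -
  let ?n = "dim_row q"
  have q': "-1 \<cdot>\<^sub>m q \<in> even_nonsingular_forms"
    using smult_even_nonsingular[OF q, of "-1"] by simp
  have s: "orth_sum q (-1 \<cdot>\<^sub>m q) \<in> even_nonsingular_forms"
    by (rule orth_sum_even_nonsingular[OF q q'])
  note c = even_nonsingular_forms_carrier[OF q]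
  have iso: "isometric (orth_sum q (-1 \<cdot>\<^sub>m q)) (hyperbolic ?n)"
    by (rule isometric_orth_sum_uminus_hyperbolic[OF c])
      (use q in \<open>simp add: even_nonsingular_forms_def\<close>)
  \<comment> \<open>The hyperbolic form inherits nonsingularity from \<open>q \<bottom> -q\<close>
    along the isometry just obtained.\<close>
  have "nonsingular (hyperbolic ?n :: 'a mat)"
    by (rule nonsingular_isometric[OF isometric_sym[OF iso even_nonsingular_forms_carrier[OF s]
            hyperbolic_carrier] hyperbolic_carrier even_nonsingular_forms_carrier[OF s]])
      (use s in \<open>simp add: even_nonsingular_forms_def\<close>)
  moreover have "quad_form (hyperbolic k :: 'a mat)" for k
  proof (induction k)
    case (Suc k)
    then show ?case
      by (simp add: hyperbolic_Suc quad_form_orth_sum quad_form_binary_form)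
  qed (simp add: hyperbolic_0 quad_form_def upper_triangular_def)
  ultimately have h: "(hyperbolic ?n :: 'a mat) \<in> even_nonsingular_forms"
    using hyperbolic_carrier[of ?n, where 'a = 'a] by (auto simp: even_nonsingular_forms_def)
  show ?thesis
    using witt_class_isometric[OF iso s h] witt_class_hyperbolic[OF h] witt_class_orth_sum[OF q q']
    by simp
qed

lemma witt_class_orth_sum_comm:
  assumes "p \<in> even_nonsingular_forms" "q \<in> even_nonsingular_forms"
  shows "witt_class p \<otimes>\<^bsub>witt_group\<^esub> witt_class q = witt_class q \<otimes>\<^bsub>witt_group\<^esub> witt_class p"
proof -
  have "isometric (orth_sum p q) (orth_sum q p)"
    by (rule isometric_orth_sum_comm) (use assms in \<open>blast intro: even_nonsingular_forms_carrier\<close>)+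
  from witt_class_isometric[OF this] show ?thesis
    using assms by (simp add: orth_sum_even_nonsingular flip: witt_class_orth_sum)
qed

lemma comm_group_witt_group: "comm_group (witt_group :: 'a::field mat set monoid)"
proof (rule comm_groupI)
  show "\<one>\<^bsub>witt_group\<^esub> \<in> carrier (witt_group :: 'a mat set monoid)"
    by (simp add: one_witt_group witt_class_in_carrier empty_even_nonsingular)
next
  fix X :: "'a mat set" assume "X \<in> carrier witt_group"
  then obtain p where p: "p \<in> even_nonsingular_forms" and X: "X = witt_class p"
    by (auto simp: carrier_witt_group)
  show "\<one>\<^bsub>witt_group\<^esub> \<otimes>\<^bsub>witt_group\<^esub> X = X"
    by (simp add: X one_witt_group p empty_even_nonsingular orth_sum_empty_left
        flip: witt_class_orth_sum)
  \<comment> \<open>The inverse of a Witt class is the class of the negative form.\<close>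
  have p': "-1 \<cdot>\<^sub>m p \<in> even_nonsingular_forms"
    using smult_even_nonsingular[OF p, of "-1"] by simp
  have "witt_class (-1 \<cdot>\<^sub>m p) \<otimes>\<^bsub>witt_group\<^esub> X = \<one>\<^bsub>witt_group\<^esub>"
    using witt_class_uminus[OF p] witt_class_orth_sum_comm[OF p p'] by (simp add: X)
  then show "\<exists>Y\<in>carrier witt_group. Y \<otimes>\<^bsub>witt_group\<^esub> X = \<one>\<^bsub>witt_group\<^esub>"
    using witt_class_in_carrier[OF p'] by blast
next
  fix X Y Z :: "'a mat set"
  assume "X \<in> carrier witt_group" "Y \<in> carrier witt_group"
  then obtain p q where p: "p \<in> even_nonsingular_forms" "X = witt_class p"
    and q: "q \<in> even_nonsingular_forms" "Y = witt_class q"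
    by (auto simp: carrier_witt_group)
  show "X \<otimes>\<^bsub>witt_group\<^esub> Y \<in> carrier witt_group"
    using p q witt_class_in_carrier[OF orth_sum_even_nonsingular] by (simp flip: witt_class_orth_sum)
  show "X \<otimes>\<^bsub>witt_group\<^esub> Y = Y \<otimes>\<^bsub>witt_group\<^esub> X"
    using p q witt_class_orth_sum_comm by simp
  assume "Z \<in> carrier witt_group"
  then obtain r where r: "r \<in> even_nonsingular_forms" "Z = witt_class r"
    by (auto simp: carrier_witt_group)
  show "X \<otimes>\<^bsub>witt_group\<^esub> Y \<otimes>\<^bsub>witt_group\<^esub> Z = X \<otimes>\<^bsub>witt_group\<^esub> (Y \<otimes>\<^bsub>witt_group\<^esub> Z)"
    using p q r by (simp add: orth_sum_even_nonsingular orth_sum_assoc flip: witt_class_orth_sum)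
qed

interpretation W: comm_group witt_group
  by (rule comm_group_witt_group)


section \<open>Pfister forms\<close>

lemma tensor_form_append:
  "tensor_form (as @ bs) q = orth_sum (tensor_form as q) (tensor_form bs q)"
  by (simp add: tensor_form_def diag_block_mat_append_orth_sum)

lemma smult_smult_mat: "a \<cdot>\<^sub>m (b \<cdot>\<^sub>m q) = (a * b) \<cdot>\<^sub>m (q :: 'a::field mat)"
  by (rule eq_matI) auto

lemma one_smult_mat: "1 \<cdot>\<^sub>m q = (q :: 'a::field mat)"
  by (rule eq_matI) auto

lemma tensor_form_map_mult: "tensor_form (map ((*) c) bs) q = c \<cdot>\<^sub>m tensor_form bs q"
proof (induction bs)
  case Nil
  show ?case by (rule eq_matI) (auto simp: tensor_form_def)
next
  case (Cons b bs)
  then show ?case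
    by (simp add: tensor_form_def diag_block_mat_Cons orth_sum_smult smult_smult_mat
        del: diag_block_mat.simps)
qed

lemma tensor_form_bil_pfister1:
  "tensor_form (bil_pfister1 \<beta>) q = orth_sum q (\<beta> \<cdot>\<^sub>m q)"
  by (simp add: tensor_form_def bil_pfister1_def diag_block_mat_Cons orth_sum_empty_right
      one_smult_mat del: diag_block_mat.simps(2))

lemma quad_pfister_form_Nil: "quad_pfister_form [] \<alpha> = binary_form 1 \<alpha>"
  by (simp add: quad_pfister_form_def bil_pfister_def tensor_form_def one_smult_mat
      diag_block_mat_Cons orth_sum_empty_right del: diag_block_mat.simps(2))

lemma quad_pfister_form_Cons:
  "quad_pfister_form (\<beta> # \<beta>s) \<alpha> = tensor_form (bil_pfister1 \<beta>) (quad_pfister_form \<beta>s \<alpha>)"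
proof -
  \<comment> \<open>\<open>bil_tensor\<close> lists the multiples by \<open>1\<close> first and then
    those by \<open>\<beta>\<close>. The new slot therefore yields two consecutive blocks, and the
    claim is a literal equality of matrices.\<close>
  have "bil_pfister (\<beta> # \<beta>s) = bil_pfister \<beta>s @ map ((*) \<beta>) (bil_pfister \<beta>s)"
    by (simp add: bil_pfister_def bil_tensor_def bil_pfister1_def map_idI)
  then show ?thesis
    by (simp add: quad_pfister_form_def tensor_form_append tensor_form_map_mult
        tensor_form_bil_pfister1)
qed

lemma tensor_form_even_nonsingular:
  "q \<in> even_nonsingular_forms \<Longrightarrow> \<beta> \<noteq> 0 \<Longrightarrow>
    tensor_form (bil_pfister1 \<beta>) q \<in> even_nonsingular_forms"
  by (simp add: tensor_form_bil_pfister1 orth_sum_even_nonsingular smult_even_nonsingular)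

lemma quad_pfister_form_even_nonsingular:
  assumes "nonsingular (binary_form 1 \<alpha>)" "\<forall>\<beta>\<in>set \<beta>s. \<beta> \<noteq> 0"
  shows "quad_pfister_form \<beta>s \<alpha> \<in> even_nonsingular_forms"
  using assms(2)
proof (induction \<beta>s)
  case Nil
  then show ?case
    using assms(1) binary_form_carrier[of 1 \<alpha>]
    by (auto simp: quad_pfister_form_Nil even_nonsingular_forms_def quad_form_binary_form)
qed (simp add: quad_pfister_form_Cons tensor_form_even_nonsingular)

text \<open>\<open>quad_pfister\<close> only records an isometry to an explicit Pfister form;
  nonsingularity and even dimension are pulled back along it.\<close>

lemma quad_pfister_imp_even_nonsingular:
  assumes "quad_pfister n q"
  shows "q \<in> even_nonsingular_forms"
proof -
  from assms obtain \<beta>s \<alpha> where q: "quad_form q" and iso: "isometric q (quad_pfister_form \<beta>s \<alpha>)"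
    and P: "quad_pfister_form \<beta>s \<alpha> \<in> even_nonsingular_forms"
    unfolding quad_pfister_def by (blast intro: quad_pfister_form_even_nonsingular)
  have "nonsingular q"
    by (rule nonsingular_isometric[OF iso quad_form_carrier[OF q] even_nonsingular_forms_carrier[OF P]])
      (use P in \<open>simp add: even_nonsingular_forms_def\<close>)
  moreover have "dim_row q = dim_row (quad_pfister_form \<beta>s \<alpha>)"
    using iso by (simp add: isometric_def)
  ultimately show ?thesis
    using q P by (simp add: even_nonsingular_forms_def)
qed

lemma isometric_tensor_form:
  assumes "isometric p q" and p: "p \<in> carrier_mat m m" and q: "q \<in> carrier_mat k k"
  shows "isometric (tensor_form (bil_pfister1 \<beta>) p) (tensor_form (bil_pfister1 \<beta>) q)"
  unfolding tensor_form_bil_pfister1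
  by (rule isometric_orth_sum[OF assms(1) isometric_smult[OF assms] p q
        smult_carrier_mat[OF p] smult_carrier_mat[OF q]])

lemma quad_pfister_tensor_form:
  assumes "quad_pfister n q" "\<beta> \<noteq> 0"
  shows "quad_pfister (Suc n) (tensor_form (bil_pfister1 \<beta>) q)"
proof -
  from assms obtain \<beta>s \<alpha> where q: "quad_form q" and len: "Suc (length \<beta>s) = n"
    and nz: "\<forall>\<beta>\<in>set \<beta>s. \<beta> \<noteq> 0" and ns: "nonsingular (binary_form 1 \<alpha>)"
    and iso: "isometric q (quad_pfister_form \<beta>s \<alpha>)"
    unfolding quad_pfister_def by blast
  have P: "quad_pfister_form \<beta>s \<alpha> \<in> even_nonsingular_forms"
    by (rule quad_pfister_form_even_nonsingular[OF ns nz])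
  have "isometric (tensor_form (bil_pfister1 \<beta>) q) (quad_pfister_form (\<beta> # \<beta>s) \<alpha>)"
    unfolding quad_pfister_form_Cons
    by (rule isometric_tensor_form[OF iso quad_form_carrier[OF q] even_nonsingular_forms_carrier[OF P]])
  moreover have "quad_form (tensor_form (bil_pfister1 \<beta>) q)"
    unfolding tensor_form_bil_pfister1 by (intro quad_form_orth_sum quad_form_smult q)
  ultimately show ?thesis
    unfolding quad_pfister_def using len nz ns assms(2)
    by (intro conjI exI[of _ "\<beta> # \<beta>s"] exI[of _ \<alpha>]) auto
qed

text \<open>The outermost slot is split off; \<open>n \<ge> 1\<close> ensures that the list of
  bilinear slots is nonempty.\<close>

lemma quad_pfister_SucE:
  assumes "quad_pfister (Suc n) q" "n \<ge> 1"
  obtains \<beta> p where "\<beta> \<noteq> 0" "quad_pfister n p" "isometric q (tensor_form (bil_pfister1 \<beta>) p)"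
proof -
  from assms(1) obtain \<beta>s' \<alpha> where len': "length \<beta>s' = n" and nz': "\<forall>\<beta>\<in>set \<beta>s'. \<beta> \<noteq> 0"
    and ns: "nonsingular (binary_form 1 \<alpha>)" and iso': "isometric q (quad_pfister_form \<beta>s' \<alpha>)"
    unfolding quad_pfister_def by auto
  from len' assms(2) obtain \<beta> \<beta>s where \<beta>s': "\<beta>s' = \<beta> # \<beta>s"
    by (cases \<beta>s') auto
  have len: "Suc (length \<beta>s) = n" and \<beta>: "\<beta> \<noteq> 0" and nz: "\<forall>\<beta>\<in>set \<beta>s. \<beta> \<noteq> 0"
    and iso: "isometric q (tensor_form (bil_pfister1 \<beta>) (quad_pfister_form \<beta>s \<alpha>))"
    using len' nz' iso' by (simp_all add: \<beta>s' quad_pfister_form_Cons)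
  let ?P = "quad_pfister_form \<beta>s \<alpha>"
  have P: "?P \<in> even_nonsingular_forms"
    by (rule quad_pfister_form_even_nonsingular[OF ns nz])
  have "quad_pfister n ?P"
    unfolding quad_pfister_def using len nz ns P
      isometric_refl[OF even_nonsingular_forms_carrier[OF P]]
    by (intro conjI exI[of _ \<beta>s] exI[of _ \<alpha>]) (auto simp: even_nonsingular_forms_def)
  with \<beta> iso that show thesis
    by blast
qed

lemma witt_class_smult_tensor_form:
  assumes "q \<in> even_nonsingular_forms" "\<beta> \<noteq> 0" "c \<noteq> 0"
  shows "witt_class (c \<cdot>\<^sub>m tensor_form (bil_pfister1 \<beta>) q) =
    witt_class (c \<cdot>\<^sub>m q) \<otimes>\<^bsub>witt_group\<^esub> witt_class ((c * \<beta>) \<cdot>\<^sub>m q)"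
  using assms by (simp add: tensor_form_bil_pfister1 orth_sum_smult smult_smult_mat
      witt_class_orth_sum smult_even_nonsingular)

lemma witt_class_tensor_form:
  assumes "q \<in> even_nonsingular_forms" "\<beta> \<noteq> 0"
  shows "witt_class (tensor_form (bil_pfister1 \<beta>) q) =
    witt_class q \<otimes>\<^bsub>witt_group\<^esub> witt_class (\<beta> \<cdot>\<^sub>m q)"
  using witt_class_smult_tensor_form[OF assms, of 1] by (simp add: one_smult_mat)


section \<open>The subgroups generated by Pfister forms\<close>

lemma witt_class_in_Iq:
  assumes "quad_pfister n q" "c \<noteq> 0"
  shows "witt_class (c \<cdot>\<^sub>m q) \<in> Iq n"
  unfolding Iq_def by (rule generate.incl) (use assms in blast)

lemma quad_pfister_in_Iq:
  assumes "quad_pfister n q"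
  shows "witt_class q \<in> Iq n"
  using witt_class_in_Iq[OF assms, of 1] by (simp add: one_smult_mat)

lemma subgroup_Iq: "subgroup (Iq n) (witt_group :: 'a::field mat set monoid)"
  unfolding Iq_def
proof (rule W.generate_is_subgroup, safe)
  fix c :: 'a and q :: "'a mat"
  assume "c \<noteq> 0" "quad_pfister n q"
  then show "witt_class (c \<cdot>\<^sub>m q) \<in> carrier witt_group"
    by (intro witt_class_in_carrier smult_even_nonsingular quad_pfister_imp_even_nonsingular)
qed

text \<open>A scaled form \<open>c \<langle>\<langle>\<beta>\<rangle>\<rangle> \<otimes> p\<close>
  splits as \<open>c p \<bottom> c \<beta> p\<close>, so each generator of the smaller group is a
  sum of two generators of the larger one.\<close>

lemma Iq_Suc_subset:
  assumes "n \<ge> 1"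
  shows "Iq (Suc n) \<subseteq> (Iq n :: 'a::field mat set set)"
  unfolding Iq_def[of "Suc n"]
proof (rule W.generate_subgroup_incl[OF _ subgroup_Iq], safe)
  fix c :: 'a and q :: "'a mat"
  assume c: "c \<noteq> 0" and q: "quad_pfister (Suc n) q"
  obtain \<beta> p where \<beta>: "\<beta> \<noteq> 0" and p: "quad_pfister n p"
    and iso: "isometric q (tensor_form (bil_pfister1 \<beta>) p)"
    using quad_pfister_SucE[OF q assms] by blast
  note p' = quad_pfister_imp_even_nonsingular[OF p]
  note q' = quad_pfister_imp_even_nonsingular[OF q]
  note t = tensor_form_even_nonsingular[OF p' \<beta>]
  have "isometric (c \<cdot>\<^sub>m q) (c \<cdot>\<^sub>m tensor_form (bil_pfister1 \<beta>) p)"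
    by (rule isometric_smult[OF iso even_nonsingular_forms_carrier[OF q']
          even_nonsingular_forms_carrier[OF t]])
  then have "witt_class (c \<cdot>\<^sub>m q) = witt_class (c \<cdot>\<^sub>m tensor_form (bil_pfister1 \<beta>) p)"
    by (rule witt_class_isometric) (use q' t c in \<open>auto intro: smult_even_nonsingular\<close>)
  also have "\<dots> = witt_class (c \<cdot>\<^sub>m p) \<otimes>\<^bsub>witt_group\<^esub> witt_class ((c * \<beta>) \<cdot>\<^sub>m p)"
    by (rule witt_class_smult_tensor_form[OF p' \<beta> c])
  also have "\<dots> \<in> Iq n"
    using c \<beta> by (intro subgroup.m_closed[OF subgroup_Iq] witt_class_in_Iq[OF p]) auto
  finally show "witt_class (c \<cdot>\<^sub>m q) \<in> Iq n" .
qed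

section \<open>The quotient of consecutive subgroups\<close>

lemma normal_Iq:
  assumes "n \<ge> 1"
  shows "Iq (Suc n) \<lhd> (witt_group\<lparr>carrier := Iq n\<rparr> :: 'a::field mat set monoid)"
  by (rule W.normal_restrict_supergroup[OF subgroup_Iq W.subgroup_imp_normal[OF subgroup_Iq]
        Iq_Suc_subset[OF assms]])

lemma group_Iq_quotient:
  assumes "n \<ge> 1"
  shows "group (Iq_quotient n :: 'a::field mat set set monoid)"
  unfolding Iq_quotient_def by (rule normal.factorgroup_is_group[OF normal_Iq[OF assms]])

text \<open>\<open>Iq_quotient\<close> takes cosets in the restricted group, \<open>Iq_class\<close>
  in the whole Witt group. Both use the same multiplication, so unfolding identifies them and the
  factor group's product rule carries over.\<close>

lemma Iq_coset_mult:
  fixes X Y :: "'a::field mat set"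
  assumes "n \<ge> 1" "X \<in> Iq n" "Y \<in> Iq n"
  shows "(Iq (Suc n) #>\<^bsub>witt_group\<^esub> X) \<otimes>\<^bsub>Iq_quotient n\<^esub> (Iq (Suc n) #>\<^bsub>witt_group\<^esub> Y)
    = Iq (Suc n) #>\<^bsub>witt_group\<^esub> (X \<otimes>\<^bsub>witt_group\<^esub> Y)"
  using normal.rcos_sum[OF normal_Iq[OF assms(1)], of X Y] assms(2,3)
  by (simp add: Iq_quotient_def FactGroup_def r_coset_def set_mult_def)

lemma Iq_coset_in_carrier:
  assumes "X \<in> Iq n"
  shows "Iq (Suc n) #>\<^bsub>witt_group\<^esub> X \<in> carrier (Iq_quotient n)"
  using assms by (auto simp: Iq_quotient_def FactGroup_def RCOSETS_def r_coset_def)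

lemma one_Iq_quotient: "\<one>\<^bsub>Iq_quotient n\<^esub> = Iq (Suc n)"
  by (simp add: Iq_quotient_def FactGroup_def)

lemma Iq_class_in_carrier:
  "quad_pfister n q \<Longrightarrow> Iq_class n q \<in> carrier (Iq_quotient n)"
  unfolding Iq_class_def by (rule Iq_coset_in_carrier[OF quad_pfister_in_Iq])

lemma Iq_class_isometric:
  "isometric p q \<Longrightarrow> quad_pfister n p \<Longrightarrow> quad_pfister n q \<Longrightarrow> Iq_class n p = Iq_class n q"
  by (simp add: Iq_class_def witt_class_isometric[OF _ quad_pfister_imp_even_nonsingular
        quad_pfister_imp_even_nonsingular])


section \<open>Right-linked Pfister forms\<close>

text \<open>In characteristic two \<open>-1 = 1\<close>, so \<open>1\<close> is the required root.
  From here on the argument is uniform in the characteristic.\<close>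

lemma minus_one_square:
  assumes "CHAR('a::field) \<noteq> 2 \<Longrightarrow> \<exists>i::'a::field. i\<^sup>2 = -1"
  obtains i :: "'a::field" where "i\<^sup>2 = -1"
proof (cases "CHAR('a) = 2")
  case True
  then have "(1::'a) + 1 = 0"
    using of_nat_CHAR[where 'a = 'a] by simp
  then have "(1::'a)\<^sup>2 = -1"
    by (simp add: eq_neg_iff_add_eq_0)
  then show thesis by (rule that)
qed (use assms that in blast)

text \<open>Since \<open>-1\<close> is the square of \<open>i\<close>, the forms \<open>-q\<close>
  and \<open>q\<close> are isometric, so the inverse of a class is the class itself.\<close>

lemma witt_class_square:
  fixes q :: "'a::field mat"
  assumes i: "(i::'a)\<^sup>2 = -1" and q: "q \<in> even_nonsingular_forms"
  shows "witt_class q \<otimes>\<^bsub>witt_group\<^esub> witt_class q = \<one>\<^bsub>witt_group\<^esub>"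
proof -
  have "i \<noteq> 0"
    using i by auto
  then have "isometric (-1 \<cdot>\<^sub>m q) q"
    using isometric_smult_square[OF even_nonsingular_forms_carrier[OF q], of i] unfolding i by simp
  then have "witt_class (-1 \<cdot>\<^sub>m q) = witt_class q"
    using q smult_even_nonsingular[OF q, of "-1"] by (intro witt_class_isometric) auto
  then show ?thesis
    using witt_class_uminus[OF q] by simp
qed

text \<open>The defect of multiplicativity is the class of
  \<open>\<langle>\<langle>\<beta>, \<gamma>\<rangle>\<rangle> \<otimes> \<phi> = \<phi> \<bottom> \<gamma>\<phi> \<bottom> \<beta>\<phi> \<bottom> \<beta>\<gamma>\<phi>\<close>, because all Witt classes have order at most two.\<close>

lemma Iq_class_tensor_form_mult:
  fixes \<phi> :: "'a::field mat"
  assumes i: "(i::'a)\<^sup>2 = -1" and m: "m \<ge> 1" and \<phi>: "quad_pfister m \<phi>"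
    and \<beta>: "\<beta> \<noteq> 0" and \<gamma>: "\<gamma> \<noteq> 0"
  shows "Iq_class (Suc m) (tensor_form (bil_pfister1 (\<beta> * \<gamma>)) \<phi>) =
    Iq_class (Suc m) (tensor_form (bil_pfister1 \<beta>) \<phi>) \<otimes>\<^bsub>Iq_quotient (Suc m)\<^esub>
    Iq_class (Suc m) (tensor_form (bil_pfister1 \<gamma>) \<phi>)"
proof -
  let ?t = "\<lambda>c. tensor_form (bil_pfister1 c) \<phi>"
  define a where "a c = witt_class (c \<cdot>\<^sub>m \<phi>)" for c
  note E = quad_pfister_imp_even_nonsingular[OF \<phi>]
  have a_carrier: "a c \<in> carrier witt_group" if "c \<noteq> 0" for c
    unfolding a_def using that by (intro witt_class_in_carrier smult_even_nonsingular E)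
  have aa: "a c \<otimes>\<^bsub>witt_group\<^esub> a c = \<one>\<^bsub>witt_group\<^esub>" if "c \<noteq> 0" for c
    unfolding a_def using that by (intro witt_class_square[OF i] smult_even_nonsingular E)
  have wt: "witt_class (?t c) = a 1 \<otimes>\<^bsub>witt_group\<^esub> a c" if "c \<noteq> 0" for c
    using witt_class_tensor_form[OF E that] by (simp add: a_def one_smult_mat)
  have wt_Iq: "witt_class (?t c) \<in> Iq (Suc m)" if "c \<noteq> 0" for c
    by (rule quad_pfister_in_Iq[OF quad_pfister_tensor_form[OF \<phi> that]])
  define x y z where "x = a \<beta>" and "y = a \<gamma>" and "z = a (\<beta> * \<gamma>)"
  have \<beta>\<gamma>: "\<beta> * \<gamma> \<noteq> 0"
    using \<beta> \<gamma> by simp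
  have [simp]: "a 1 \<in> carrier witt_group" "x \<in> carrier witt_group" "y \<in> carrier witt_group"
    "z \<in> carrier witt_group"
    by (simp_all add: a_carrier \<beta> \<gamma> x_def y_def z_def)
  define h where "h = witt_class (tensor_form (bil_pfister1 \<beta>) (?t \<gamma>))"
  have h_Iq: "h \<in> Iq (Suc (Suc m))"
    unfolding h_def
    by (intro quad_pfister_in_Iq quad_pfister_tensor_form \<phi> \<beta> \<gamma>)
  have h: "h = (a 1 \<otimes>\<^bsub>witt_group\<^esub> y) \<otimes>\<^bsub>witt_group\<^esub> (x \<otimes>\<^bsub>witt_group\<^esub> z)"
    unfolding h_def witt_class_tensor_form[OF tensor_form_even_nonsingular[OF E \<gamma>] \<beta>]
      witt_class_smult_tensor_form[OF E \<gamma> \<beta>] wt[OF \<gamma>]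
    by (simp add: x_def y_def z_def a_def)
  have zz: "z \<otimes>\<^bsub>witt_group\<^esub> z = \<one>\<^bsub>witt_group\<^esub>"
    using aa[OF \<beta>\<gamma>] by (simp add: z_def)
  have "h \<otimes>\<^bsub>witt_group\<^esub> witt_class (?t (\<beta> * \<gamma>))
      = witt_class (?t \<beta>) \<otimes>\<^bsub>witt_group\<^esub> witt_class (?t \<gamma>)"
  proof -
    \<comment> \<open>Written additively, the left side consists of \<open>a 1\<close> twice,
      \<open>x\<close>, \<open>y\<close>, and \<open>z\<close> twice; the pair of \<open>z\<close>
      is collected so that \<open>zz\<close> removes it.\<close>
    have "h \<otimes>\<^bsub>witt_group\<^esub> (a 1 \<otimes>\<^bsub>witt_group\<^esub> z)
        = (a 1 \<otimes>\<^bsub>witt_group\<^esub> x) \<otimes>\<^bsub>witt_group\<^esub> (a 1 \<otimes>\<^bsub>witt_group\<^esub> y) \<otimes>\<^bsub>witt_group\<^esub> (z \<otimes>\<^bsub>witt_group\<^esub> z)"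
      unfolding h by (simp add: W.m_ac)
    then show ?thesis
      by (simp add: wt \<beta> \<gamma> zz flip: x_def y_def z_def)
  qed
  then have "Iq_class (Suc m) (?t \<beta>) \<otimes>\<^bsub>Iq_quotient (Suc m)\<^esub> Iq_class (Suc m) (?t \<gamma>)
      = Iq (Suc (Suc m)) #>\<^bsub>witt_group\<^esub> (h \<otimes>\<^bsub>witt_group\<^esub> witt_class (?t (\<beta> * \<gamma>)))"
    unfolding Iq_class_def by (simp add: Iq_coset_mult wt_Iq \<beta> \<gamma>)
  also have "\<dots> = (Iq (Suc (Suc m)) #>\<^bsub>witt_group\<^esub> h) #>\<^bsub>witt_group\<^esub> witt_class (?t (\<beta> * \<gamma>))"
    by (rule W.coset_mult_assoc[symmetric])
      (use h_Iq wt_Iq[OF \<beta>\<gamma>] subgroup.subset[OF subgroup_Iq] in blast)+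
  \<comment> \<open>As \<open>h\<close> lies in the subgroup that is factored out, translation by it
    does not move the coset.\<close>
  also have "Iq (Suc (Suc m)) #>\<^bsub>witt_group\<^esub> h = Iq (Suc (Suc m))"
    by (rule W.coset_join2[OF _ subgroup_Iq h_Iq])
      (use h_Iq subgroup.subset[OF subgroup_Iq] in blast)
  finally show ?thesis
    by (simp add: Iq_class_def)
qed

text \<open>This form is \<open>\<phi> \<bottom> \<phi>\<close>, which is already trivial in the
  Witt group. It provides the value at the empty product.\<close>

lemma Iq_class_tensor_form_one:
  fixes \<phi> :: "'a::field mat"
  assumes i: "(i::'a)\<^sup>2 = -1" and \<phi>: "quad_pfister m \<phi>"
  shows "Iq_class n (tensor_form (bil_pfister1 1) \<phi>) = \<one>\<^bsub>Iq_quotient n\<^esub>"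
proof -
  note E = quad_pfister_imp_even_nonsingular[OF \<phi>]
  have "witt_class (tensor_form (bil_pfister1 1) \<phi>) = \<one>\<^bsub>witt_group\<^esub>"
    using witt_class_tensor_form[OF E, of 1] witt_class_square[OF i E] by (simp add: one_smult_mat)
  then show ?thesis
    by (simp add: Iq_class_def one_Iq_quotient W.coset_mult_one subgroup.subset[OF subgroup_Iq])
qed

lemma Iq_class_square:
  fixes q :: "'a::field mat"
  assumes i: "(i::'a)\<^sup>2 = -1" and n: "n \<ge> 1" and q: "quad_pfister n q"
  shows "Iq_class n q \<otimes>\<^bsub>Iq_quotient n\<^esub> Iq_class n q = \<one>\<^bsub>Iq_quotient n\<^esub>"
  using Iq_coset_mult[OF n quad_pfister_in_Iq[OF q] quad_pfister_in_Iq[OF q]]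
    witt_class_square[OF i quad_pfister_imp_even_nonsingular[OF q]]
  by (simp add: Iq_class_def one_Iq_quotient W.coset_mult_one subgroup.subset[OF subgroup_Iq])

text \<open>On the multiplicatively closed set \<open>P\<close>, \<open>f\<close> preserves products
  and takes values of order at most two. The values at two subset products then multiply to the
  value at the symmetric difference, since the common part squares to \<open>\<one>\<close>. So the
  subset products already form a subgroup. Indexing by \<open>I\<close> allows repeated values of
  \<open>\<beta>\<close>.\<close>

lemma (in group) generate_image_products:
  fixes f :: "'c::comm_monoid_mult \<Rightarrow> 'a" and \<beta> :: "'i \<Rightarrow> 'c"
  assumes fin: "finite I" and P: "\<And>i. i \<in> I \<Longrightarrow> \<beta> i \<in> P" "1 \<in> P"
      "\<And>x y. x \<in> P \<Longrightarrow> y \<in> P \<Longrightarrow> x * y \<in> P"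
    and f: "\<And>x. x \<in> P \<Longrightarrow> f x \<in> carrier G" "f 1 = \<one>"
      "\<And>x y. x \<in> P \<Longrightarrow> y \<in> P \<Longrightarrow> f (x * y) = f x \<otimes> f y"
      "\<And>x. x \<in> P \<Longrightarrow> f x \<otimes> f x = \<one>"
  shows "generate G ((f \<circ> \<beta>) ` I) = {f (\<Prod>i\<in>J. \<beta> i) | J. J \<subseteq> I}" (is "?L = ?R")
proof
  have prod_P: "(\<Prod>i\<in>J. \<beta> i) \<in> P" if "J \<subseteq> I" for J
    using finite_subset[OF that fin] that
    by (induction J rule: finite_induct) (auto intro: P)
  have *: "f (\<Prod>i\<in>J. \<beta> i) \<otimes> f (\<Prod>i\<in>K. \<beta> i) = f (\<Prod>i\<in>(J - K) \<union> (K - J). \<beta> i)"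
    if J: "J \<subseteq> I" and K: "K \<subseteq> I" for J K
  proof -
    note fJ = finite_subset[OF J fin] and fK = finite_subset[OF K fin]
    have Q: "(\<Prod>i\<in>J - K. \<beta> i) \<in> P" "(\<Prod>i\<in>K - J. \<beta> i) \<in> P" "(\<Prod>i\<in>J \<inter> K. \<beta> i) \<in> P"
      using J K by (auto intro!: prod_P)
    \<comment> \<open>The common part comes last in one product and first in the other, so that its
      two images are adjacent in \<open>G\<close>, which may be noncommutative.\<close>
    have "(\<Prod>i\<in>J. \<beta> i) = (\<Prod>i\<in>J - K. \<beta> i) * (\<Prod>i\<in>J \<inter> K. \<beta> i)"
      using prod.Int_Diff[OF fJ, of \<beta> K] by (simp add: mult.commute)
    moreover have "(\<Prod>i\<in>K. \<beta> i) = (\<Prod>i\<in>J \<inter> K. \<beta> i) * (\<Prod>i\<in>K - J. \<beta> i)"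
      using prod.Int_Diff[OF fK, of \<beta> J] by (simp add: Int_commute)
    ultimately have "f (\<Prod>i\<in>J. \<beta> i) \<otimes> f (\<Prod>i\<in>K. \<beta> i)
        = (f (\<Prod>i\<in>J - K. \<beta> i) \<otimes> (f (\<Prod>i\<in>J \<inter> K. \<beta> i) \<otimes> f (\<Prod>i\<in>J \<inter> K. \<beta> i)))
          \<otimes> f (\<Prod>i\<in>K - J. \<beta> i)"
      using Q by (simp add: f(1,3) m_assoc)
    also have "\<dots> = f (\<Prod>i\<in>(J - K) \<union> (K - J). \<beta> i)"
      using Q fJ fK by (subst prod.union_disjoint) (auto simp: f)
    finally show ?thesis .
  qed
  have mult: "x \<otimes> y \<in> ?R" if "x \<in> ?R" "y \<in> ?R" for x y
  proof -
    from that obtain J K where JK: "J \<subseteq> I" "K \<subseteq> I"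
      and x: "x = f (\<Prod>i\<in>J. \<beta> i)" and y: "y = f (\<Prod>i\<in>K. \<beta> i)"
      by blast
    have "x \<otimes> y = f (\<Prod>i\<in>(J - K) \<union> (K - J). \<beta> i)"
      unfolding x y by (rule *[OF JK])
    moreover have "(J - K) \<union> (K - J) \<subseteq> I"
      using JK by blast
    ultimately show ?thesis by blast
  qed
  \<comment> \<open>Each such element squares to \<open>\<one>\<close> and is its own inverse, which
    reduces the inverse case of \<open>generate\<close> to the generator case.\<close>
  have inv_eq: "inv x = x" if "x \<in> ?R" for x
  proof -
    from that obtain J where "J \<subseteq> I" and x: "x = f (\<Prod>i\<in>J. \<beta> i)"
      by blast
    from f(1,4)[OF prod_P[OF this(1)]] show ?thesis
      unfolding x by (intro inv_equality)
  qed
  show "?L \<subseteq> ?R"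
  proof
    fix x assume "x \<in> ?L"
    then show "x \<in> ?R"
    proof (induction rule: generate.induct)
      case one
      have "\<one> = f (\<Prod>i\<in>{}. \<beta> i)" using f(2) by simp
      then show ?case by blast
    next
      case (incl h)
      then obtain i where "i \<in> I" "h = f (\<beta> i)" by auto
      then have "{i} \<subseteq> I" "h = f (\<Prod>i\<in>{i}. \<beta> i)" by auto
      then show ?case by blast
    next
      case (inv h)
      then obtain i where "i \<in> I" "h = f (\<beta> i)" by auto
      then have "{i} \<subseteq> I" "h = f (\<Prod>i\<in>{i}. \<beta> i)" by auto
      then have "h \<in> ?R" by blast
      then show ?case using inv_eq by simp
    next
      case (eng g h)
      then show ?case by (intro mult)
    qed
  qed
  show "?R \<subseteq> ?L"
  proof clarify
    fix J assume "J \<subseteq> I"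
    with finite_subset[OF this fin] show "f (\<Prod>i\<in>J. \<beta> i) \<in> ?L"
    \<comment> \<open>Multiplicativity peels off one index at a time and rewrites the value at a
      product as a product of generators.\<close>
    proof (induction J rule: finite_induct)
      case empty
      show ?case by (simp add: f(2) generate.one)
    next
      case (insert j J)
      then have "f (\<Prod>i\<in>insert j J. \<beta> i) = f (\<beta> j) \<otimes> f (\<Prod>i\<in>J. \<beta> i)"
        using P(1) prod_P by (simp add: f(3))
      moreover have "f (\<beta> j) \<in> ?L"
        using insert.prems by (intro generate.incl) auto
      ultimately show ?case
        using insert by (simp add: generate.eng)
    qed
  qed
qed

section \<open>Subset products of the slots of a right-linked set\<close>

theorem proposition3p4:
  fixes S :: "'a::field mat set" and n :: nat
  assumes "CHAR('a) \<noteq> 2 \<Longrightarrow> \<exists>i::'a. i\<^sup>2 = -1"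
    and "n \<ge> 2"
    and "finite S"
    and "\<forall>q \<in> S. quad_pfister n q"
    and "right_linked n S"
  shows "\<exists>\<phi> (s::nat) (\<beta> :: nat \<Rightarrow> 'a).
           quad_pfister (n - 1) \<phi> \<and> (\<forall>i \<in> {1..s}. \<beta> i \<noteq> 0) \<and>
           generate (Iq_quotient n) (Iq_class n ` S) =
             {Iq_class n (tensor_form (bil_pfister1 (\<Prod>i\<in>J. \<beta> i)) \<phi>) | J. J \<subseteq> {1..s}}"
proof -
  obtain i :: 'a where i: "i\<^sup>2 = -1"
    using minus_one_square assms(1) by blast
  \<comment> \<open>One right factor \<open>\<phi>\<close> serves all of \<open>S\<close>; the
    choice function \<open>b\<close> fixes a slot for each form.\<close>
  from assms(5) obtain \<phi> b where \<phi>: "quad_pfister (n - 1) \<phi>"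
    and b: "\<And>q. q \<in> S \<Longrightarrow> b q \<noteq> 0 \<and> isometric q (tensor_form (bil_pfister1 (b q)) \<phi>)"
    unfolding right_linked_def by metis
  define m where "m = n - 1"
  have m: "m \<ge> 1" and n: "n = Suc m"
    using assms(2) by (auto simp: m_def)
  note \<phi>' = \<phi>[folded m_def]
  \<comment> \<open>The number \<open>s\<close> will be \<open>card S\<close>, and an enumeration
    starting at 1 turns the slots into the family \<open>\<beta>\<close>. Distinct forms may receive
    equal slots.\<close>
  obtain e where e: "bij_betw e {1..card S} S"
    using ex_bij_betw_nat_finite_1[OF assms(3)] by blast
  define \<beta> where "\<beta> = b \<circ> e"
  define f where "f c = Iq_class n (tensor_form (bil_pfister1 c) \<phi>)" for c
  have eS: "e j \<in> S" if "j \<in> {1..card S}" for j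
    using bij_betwE[OF e] that by blast
  have \<beta>: "\<beta> j \<noteq> 0" if "j \<in> {1..card S}" for j
    using b[OF eS[OF that]] by (simp add: \<beta>_def)
  have f_carrier: "f c \<in> carrier (Iq_quotient n)" if "c \<noteq> 0" for c
    unfolding f_def n by (rule Iq_class_in_carrier[OF quad_pfister_tensor_form[OF \<phi>' that]])
  have f_one: "f 1 = \<one>\<^bsub>Iq_quotient n\<^esub>"
    unfolding f_def by (rule Iq_class_tensor_form_one[OF i \<phi>])
  have f_mult: "f (c * d) = f c \<otimes>\<^bsub>Iq_quotient n\<^esub> f d" if "c \<noteq> 0" "d \<noteq> 0" for c d
    unfolding f_def n by (rule Iq_class_tensor_form_mult[OF i m \<phi>' that])
  have f_square: "f c \<otimes>\<^bsub>Iq_quotient n\<^esub> f c = \<one>\<^bsub>Iq_quotient n\<^esub>" if "c \<noteq> 0" for c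
    unfolding f_def n by (rule Iq_class_square[OF i _ quad_pfister_tensor_form[OF \<phi>' that]]) simp
  have "Iq_class n ` S = (f \<circ> \<beta>) ` {1..card S}"
  proof -
    \<comment> \<open>The class of a form depends only on its isometry type, so \<open>q\<close> may
      be replaced by the product of its slot form with \<open>\<phi>\<close>.\<close>
    have "f (b q) = Iq_class n q" if q: "q \<in> S" for q
      unfolding f_def
      using b[OF q] assms(4) q quad_pfister_tensor_form[OF \<phi>'] n
      by (intro Iq_class_isometric[symmetric]) auto
    then have "Iq_class n ` S = (\<lambda>q. f (b q)) ` S"
      by simp
    also have "\<dots> = (\<lambda>q. f (b q)) ` e ` {1..card S}"
      by (simp only: bij_betw_imp_surj_on[OF e])
    also have "\<dots> = (f \<circ> \<beta>) ` {1..card S}"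
      by (simp only: image_comp \<beta>_def comp_def)
    finally show ?thesis .
  qed
  moreover have "generate (Iq_quotient n) ((f \<circ> \<beta>) ` {1..card S})
      = {f (\<Prod>i\<in>J. \<beta> i) | J. J \<subseteq> {1..card S}}"
    \<comment> \<open>\<open>P\<close> is the set of nonzero scalars: it contains every slot, is
      closed under products in a field, and is where the laws for \<open>f\<close> were
      proved.\<close>
    by (rule group.generate_image_products[OF group_Iq_quotient, where P = "{c. c \<noteq> 0}"])
      (use assms(2) \<beta> f_carrier f_one f_mult f_square in auto)
  ultimately show ?thesis
    using \<phi> \<beta> unfolding f_def
    by (intro exI[of _ \<phi>] exI[of _ "card S"] exI[of _ \<beta>]) simp
qed

end
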